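(* Let $n,k\ge3$, $s\ge2$, $1\le t\le\frac12(6k^2-15k+10)(s-1)+1$ and $0\le\alpha<1$. Let $H$ be a connected linear $k$-graph on $n$ vertices. If $H$ contains neither a Berge-$B_s$ nor a Berge-$K_{2,t}$, then $$\rho_\alpha^2(H)\le \alpha\frac{(n-1)^2}{(k-1)^2}+(1-\alpha)\frac{(6k^2-15k+10)(s-1)(n-1)}{2(k-1)^2}.$$
   Context: A $k$-graph ($k$-uniform hypergraph) $H$ consists of a finite vertex set $V(H)$ and a set $E(H)$ of $k$-element subsets of $V(H)$ (edges). $H$ is linear if any two distinct edges share at most one vertex. Two vertices are adjacent if some edge contains both; $H$ is connected if the graph on $V(H)$ with this adjacency relation is connected. The degree $d_v$ of a vertex $v$ is the number of edges containing $v$. For $V(H)=\{v_1,\dots,v_n\}$, the adjacency tensor $\mathcal{A}(H)=(a_{i_1\dots i_k})$ is the order-$k$, dimension-$n$ tensor with $a_{i_1\dots i_k}=\frac{1}{(k-1)!}$ if $\{v_{i_1},\dots,v_{i_k}\}\in E(H)$ and $0$ otherwise; $\mathcal{D}(H)$ is the diagonal tensor with entries $d_{i\dots i}=d_{v_i}$ and all other entries $0$. For $0\le\alpha<1$, $\mathcal{A}_\alpha(H)=\alpha\mathcal{D}(H)+(1-\alpha)\mathcal{A}(H)$. A number $\lambda\in\mathbb{C}$ is an eigenvalue of an order-$k$ dimension-$n$ tensor $\mathcal{A}=(a_{i_1\dots i_k})$ if there is a nonzero $\mathbf{x}\in\mathbb{C}^n$ with $\sum_{i_2,\dots,i_k=1}^n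 a_{i i_2\dots i_k}x_{i_2}\cdots x_{i_k}=\lambda x_i^{k-1}$ for all $i$; the spectral radius is the largest modulus of an eigenvalue. $\rho_\alpha(H)$ denotes the spectral radius of $\mathcal{A}_\alpha(H)$. For a graph $G$, a hypergraph $F$ is a Berge-$G$ if there is a bijection $\varphi:E(G)\to E(F)$ with $e\subseteq\varphi(e)$ for every $e\in E(G)$; $H$ contains a Berge-$G$ if some subhypergraph of $H$ is a Berge-$G$. The $s$-book $B_s$ is the graph consisting of $s$ triangles sharing one common edge (vertices $x,y,w_1,\dots,w_s$, edges $xy$, $xw_i$, $yw_i$). $K_{2,t}$ is the complete bipartite graph with parts of sizes $2$ and $t$. *)

theory Defs
  imports "HOL-Analysis.Analysis"
begin

definition uniform_hypergraph :: "nat \<Rightarrow> 'a set \<Rightarrow> 'a set set \<Rightarrow> bool" where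
  "uniform_hypergraph k V E \<longleftrightarrow> finite V \<and> (\<forall>e\<in>E. e \<subseteq> V \<and> card e = k)"

definition linear_hypergraph :: "'a set set \<Rightarrow> bool" where
  "linear_hypergraph E \<longleftrightarrow> (\<forall>e\<in>E. \<forall>f\<in>E. e \<noteq> f \<longrightarrow> card (e \<inter> f) \<le> 1)"

definition hyper_adjacent :: "'a set set \<Rightarrow> 'a \<Rightarrow> 'a \<Rightarrow> bool" where
  "hyper_adjacent E u v \<longleftrightarrow> u \<noteq> v \<and> (\<exists>e\<in>E. u \<in> e \<and> v \<in> e)"

definition connected_hypergraph :: "'a set \<Rightarrow> 'a set set \<Rightarrow> bool" where
  "connected_hypergraph V E \<longleftrightarrow>
     (\<forall>u\<in>V. \<forall>v\<in>V. (u, v) \<in> {(a, b). a \<in> V \<and> b \<in> V \<and> hyper_adjacent E a b}\<^sup>*)"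

definition hyper_degree :: "'a set set \<Rightarrow> 'a \<Rightarrow> nat" where
  "hyper_degree E v = card {e \<in> E. v \<in> e}"

text \<open>
  A tensor of order \<open>k\<close> whose dimensions are indexed by a finite set \<open>V\<close> is a function on
  lists, of which only the values on lists of length \<open>k\<close> over \<open>V\<close> are relevant.
\<close>

definition tensor_apply ::
  "nat \<Rightarrow> 'a set \<Rightarrow> ('a list \<Rightarrow> complex) \<Rightarrow> ('a \<Rightarrow> complex) \<Rightarrow> 'a \<Rightarrow> complex" where
  "tensor_apply k V T x i =
     (\<Sum>js \<in> {js. set js \<subseteq> V \<and> length js = k - 1}. T (i # js) * prod_list (map x js))"

definition tensor_eigenvalue :: "nat \<Rightarrow> 'a set \<Rightarrow> ('a list \<Rightarrow> complex) \<Rightarrow> complex \<Rightarrow> bool" where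
  "tensor_eigenvalue k V T \<mu> \<longleftrightarrow>
     (\<exists>x. (\<exists>i\<in>V. x i \<noteq> 0) \<and> (\<forall>i\<in>V. tensor_apply k V T x i = \<mu> * x i ^ (k - 1)))"

text \<open>
  The supremum is attained whenever there is an eigenvalue at all; see
  \<open>tensor_spectral_radius_greatest\<close> below.
\<close>

definition tensor_spectral_radius :: "nat \<Rightarrow> 'a set \<Rightarrow> ('a list \<Rightarrow> complex) \<Rightarrow> real" where
  "tensor_spectral_radius k V T = Sup (cmod ` {\<mu>. tensor_eigenvalue k V T \<mu>})"

text \<open>
  If every edge has \<open>k\<close> elements, a list of length \<open>k\<close> whose set is an edge is distinct.
\<close>

definition adjacency_tensor :: "nat \<Rightarrow> 'a set set \<Rightarrow> 'a list \<Rightarrow> real" where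
  "adjacency_tensor k E js = (if length js = k \<and> set js \<in> E then 1 / fact (k - 1) else 0)"

definition degree_tensor :: "nat \<Rightarrow> 'a set set \<Rightarrow> 'a list \<Rightarrow> real" where
  "degree_tensor k E js = (if js = replicate k (hd js) then real (hyper_degree E (hd js)) else 0)"

definition alpha_tensor :: "real \<Rightarrow> nat \<Rightarrow> 'a set set \<Rightarrow> 'a list \<Rightarrow> real" where
  "alpha_tensor \<alpha> k E js = \<alpha> * degree_tensor k E js + (1 - \<alpha>) * adjacency_tensor k E js"

definition alpha_spectral_radius :: "real \<Rightarrow> nat \<Rightarrow> 'a set \<Rightarrow> 'a set set \<Rightarrow> real" where
  "alpha_spectral_radius \<alpha> k V E =
     tensor_spectral_radius k V (\<lambda>js. complex_of_real (alpha_tensor \<alpha> k E js))"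

text \<open>
  The injection \<open>h\<close> places a copy of \<open>G = (VG, EG)\<close> on the vertices of \<open>F = (VF, EF)\<close>;
  the edge \<open>h ` e\<close> of that copy has to lie inside its hyperedge \<open>\<phi> e\<close>.
\<close>

definition is_berge :: "'b set \<Rightarrow> 'b set set \<Rightarrow> 'a set \<Rightarrow> 'a set set \<Rightarrow> bool" where
  "is_berge VG EG VF EF \<longleftrightarrow>
     (\<exists>h \<phi>. inj_on h VG \<and> h ` VG \<subseteq> VF \<and> bij_betw \<phi> EG EF \<and> (\<forall>e\<in>EG. h ` e \<subseteq> \<phi> e))"

definition contains_berge :: "'b set \<Rightarrow> 'b set set \<Rightarrow> 'a set \<Rightarrow> 'a set set \<Rightarrow> bool" where
  "contains_berge VG EG V E \<longleftrightarrow>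
     (\<exists>VF EF. VF \<subseteq> V \<and> EF \<subseteq> E \<and> (\<forall>e\<in>EF. e \<subseteq> VF) \<and> is_berge VG EG VF EF)"

text \<open>
  In both graphs the vertices \<open>2, \<dots>, s + 1\<close> (resp. \<open>2, \<dots>, t + 1\<close>) are the common neighbours of
  \<open>0\<close> and \<open>1\<close>.
\<close>

definition book_verts :: "nat \<Rightarrow> nat set" where
  "book_verts s = {..<s + 2}"

definition book_edges :: "nat \<Rightarrow> nat set set" where
  "book_edges s = {{0, 1}} \<union> (\<Union>i\<in>{2..<s + 2}. {{0, i}, {1, i}})"

definition K2_verts :: "nat \<Rightarrow> nat set" where
  "K2_verts t = {..<t + 2}"

definition K2_edges :: "nat \<Rightarrow> nat set set" where
  "K2_edges t = (\<Union>i\<in>{2..<t + 2}. {{0, i}, {1, i}})"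

lemma tensor_apply_scale:
  "tensor_apply k V T (\<lambda>i. if i \<in> V then x i / c else 0) i = tensor_apply k V T x i / c ^ (k - 1)"
proof -
  have scale: "prod_list (map (\<lambda>i. if i \<in> V then x i / c else 0) js)
      = prod_list (map x js) / c ^ length js" if "set js \<subseteq> V" for js
    using that by (induction js) auto
  show ?thesis
    unfolding tensor_apply_def sum_divide_distrib
    by (rule sum.cong) (auto simp: scale)
qed

lemma continuous_on_tensor_apply: "continuous_on S (\<lambda>x. tensor_apply k V T x i)"
proof -
  have coord: "continuous_on S (\<lambda>x::'a \<Rightarrow> complex. x j)" for j
    by (rule continuous_on_subset[OF continuous_on_product_coordinates]) simp
  have "continuous_on S (\<lambda>x::'a \<Rightarrow> complex. prod_list (map x js))" for js
    by (induction js) (auto intro!: continuous_intros coord)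
  then show ?thesis
    unfolding tensor_apply_def by (intro continuous_intros)
qed

lemma compact_tensor_eigenvalues:
  assumes "finite V"
  shows "compact {\<mu>. tensor_eigenvalue k V T \<mu>}"
proof -
  define S :: "('a \<Rightarrow> complex) set"
    where "S = PiE UNIV (\<lambda>i. if i \<in> V then cball 0 1 else {0})"
  define K where "K v = S \<inter> {x. x v = 1} \<inter>
      (\<Inter>i\<in>V. {x. tensor_apply k V T x i = tensor_apply k V T x v * x i ^ (k - 1)})" for v
  have coord: "continuous_on UNIV (\<lambda>x::'a \<Rightarrow> complex. x j)" for j
    by simp
  have "compactin (product_topology (\<lambda>_. euclidean) UNIV) S"
    unfolding S_def compactin_PiE by auto
  then have "compact S"
    by (simp add: euclidean_product_topology)
  moreover have "closed {x::'a \<Rightarrow> complex. x v = 1}" for v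
    by (intro closed_Collect_eq coord continuous_intros)
  moreover have "closed (\<Inter>i\<in>V. {x. tensor_apply k V T x i
      = tensor_apply k V T x v * x i ^ (k - 1)})" for v
    by (intro closed_INT ballI closed_Collect_eq continuous_intros
        continuous_on_tensor_apply coord)
  ultimately have "compact (K v)" for v
    unfolding K_def by (intro compact_Int_closed)
  then have "compact (\<Union>v\<in>V. (\<lambda>x. tensor_apply k V T x v) ` K v)"
    using assms
    by (intro compact_UN compact_continuous_image continuous_on_tensor_apply) auto
  moreover have "{\<mu>. tensor_eigenvalue k V T \<mu>} = (\<Union>v\<in>V. (\<lambda>x. tensor_apply k V T x v) ` K v)"
  proof (intro set_eqI iffI)
    fix \<mu> assume "\<mu> \<in> {\<mu>. tensor_eigenvalue k V T \<mu>}"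
    then obtain x i where i: "i \<in> V" "x i \<noteq> 0"
      and eq: "\<forall>i\<in>V. tensor_apply k V T x i = \<mu> * x i ^ (k - 1)"
      by (auto simp: tensor_eigenvalue_def)
    define m where "m = Max ((\<lambda>i. cmod (x i)) ` V)"
    have "m \<in> (\<lambda>i. cmod (x i)) ` V"
      unfolding m_def using assms i by (intro Max_in) auto
    then obtain v where v: "v \<in> V" "m = cmod (x v)" by auto
    have le: "cmod (x j) \<le> cmod (x v)" if "j \<in> V" for j
      using that assms unfolding v(2)[symmetric] m_def by auto
    with i have "x v \<noteq> 0" by force
    define y where "y = (\<lambda>i. if i \<in> V then x i / x v else 0)"
    have ty: "tensor_apply k V T y j = \<mu> * y j ^ (k - 1)" if "j \<in> V" for j
      using eq that unfolding y_def tensor_apply_scale by (simp add: power_divide)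
    have "y v = 1" using v \<open>x v \<noteq> 0\<close> by (simp add: y_def)
    have "y \<in> S"
      using le \<open>x v \<noteq> 0\<close> unfolding S_def y_def by (auto simp: norm_divide)
    have tv: "tensor_apply k V T y v = \<mu>"
      using ty[OF v(1)] \<open>y v = 1\<close> by simp
    have "y \<in> K v"
      unfolding K_def using \<open>y \<in> S\<close> \<open>y v = 1\<close> tv ty by auto
    then show "\<mu> \<in> (\<Union>v\<in>V. (\<lambda>x. tensor_apply k V T x v) ` K v)"
      using tv v(1) by blast
  next
    fix \<mu> assume "\<mu> \<in> (\<Union>v\<in>V. (\<lambda>x. tensor_apply k V T x v) ` K v)"
    then obtain v x where v: "v \<in> V" and x: "x \<in> K v" "\<mu> = tensor_apply k V T x v"
      by blast
    have "x v \<noteq> 0" "\<forall>i\<in>V. tensor_apply k V T x i = \<mu> * x i ^ (k - 1)"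
      using x unfolding K_def by auto
    with v show "\<mu> \<in> {\<mu>. tensor_eigenvalue k V T \<mu>}"
      unfolding tensor_eigenvalue_def by blast
  qed
  ultimately show ?thesis by simp
qed

lemma tensor_spectral_radius_greatest:
  assumes "finite V" "tensor_eigenvalue k V T \<nu>"
  shows "\<exists>\<mu>. tensor_eigenvalue k V T \<mu> \<and> cmod \<mu> = tensor_spectral_radius k V T"
    and "cmod \<nu> \<le> tensor_spectral_radius k V T"
proof -
  let ?R = "cmod ` {\<mu>. tensor_eigenvalue k V T \<mu>}"
  have c: "compact ?R"
    by (intro compact_continuous_image compact_tensor_eigenvalues assms continuous_intros)
  have ne: "?R \<noteq> {}" using assms(2) by auto
  have bdd: "bdd_above ?R" by (rule bounded_imp_bdd_above[OF compact_imp_bounded[OF c]])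
  have "Sup ?R \<in> ?R"
    by (rule closed_contains_Sup[OF ne bdd compact_imp_closed[OF c]])
  then show "\<exists>\<mu>. tensor_eigenvalue k V T \<mu> \<and> cmod \<mu> = tensor_spectral_radius k V T"
    unfolding tensor_spectral_radius_def by (smt (verit) image_iff mem_Collect_eq)
  show "cmod \<nu> \<le> tensor_spectral_radius k V T"
    unfolding tensor_spectral_radius_def using assms(2) bdd by (intro cSup_upper) auto
qed

text \<open>
  For \<open>k \<ge> 3\<close> the indicator of a vertex is an eigenvector, so the spectral radius of
  \<open>\<A>\<^sub>\<alpha>\<close> is a genuine maximum.
\<close>

lemma alpha_tensor_eigenvalue_exists:
  assumes "k \<ge> 3" "uniform_hypergraph k V E" "v \<in> V"
  shows "tensor_eigenvalue k V (\<lambda>js. complex_of_real (alpha_tensor \<alpha> k E js))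
           (complex_of_real (\<alpha> * real (hyper_degree E v)))"
proof -
  let ?T = "\<lambda>js. complex_of_real (alpha_tensor \<alpha> k E js)"
  define x :: "'a \<Rightarrow> complex" where "x = (\<lambda>i. if i = v then 1 else 0)"
  have fin: "finite V" using assms by (simp add: uniform_hypergraph_def)
  have px: "prod_list (map x js) = (if js = replicate (length js) v then 1 else 0)" for js
    by (induction js) (auto simp: x_def)
  have "tensor_apply k V ?T x i = of_real (\<alpha> * real (hyper_degree E v)) * x i ^ (k - 1)" for i
  proof -
    let ?J = "{js. set js \<subseteq> V \<and> length js = k - 1}"
    have "tensor_apply k V ?T x i
        = (\<Sum>js\<in>?J. if js = replicate (k - 1) v then ?T (i # js) else 0)"
      unfolding tensor_apply_def by (rule sum.cong) (auto simp: px)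
    also have "\<dots> = ?T (i # replicate (k - 1) v)"
      using assms(3) finite_lists_length_eq[OF fin, of "k - 1"] by (subst sum.delta) auto
    also have "set (i # replicate (k - 1) v) \<notin> E"
    proof
      assume "set (i # replicate (k - 1) v) \<in> E"
      then have "card (set (i # replicate (k - 1) v)) = k"
        using assms(2) unfolding uniform_hypergraph_def by blast
      moreover have "card (set (i # replicate (k - 1) v)) \<le> 2"
        using assms(1) by (auto simp: card_insert_if)
      ultimately show False using assms(1) by simp
    qed
    then have "?T (i # replicate (k - 1) v) = of_real (\<alpha> * degree_tensor k E (i # replicate (k - 1) v))"
      by (simp only: alpha_tensor_def adjacency_tensor_def) simp
    also have "degree_tensor k E (i # replicate (k - 1) v)
        = (if i = v then real (hyper_degree E v) else 0)"
    proof -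
      obtain m where "k = Suc (Suc m)" using assms(1) by (metis Suc_le_D numeral_3_eq_3 Suc_le_mono)
      then show ?thesis by (auto simp: degree_tensor_def)
    qed
    finally show ?thesis using assms(1) by (auto simp: x_def)
  qed
  then show ?thesis
    unfolding tensor_eigenvalue_def using assms(3)
    by (intro exI[of _ x]) (auto simp: x_def)
qed

end

theory Submission
  imports Defs "HOL-Combinatorics.Multiset_Permutations"
begin

text \<open>
  Let \<open>y i = \<bar>x i\<bar> ^ (k - 1)\<close> for an eigenvector \<open>x\<close>. By AM-GM the eigenvalue equation becomes the
  inequality \<open>(k - 1) \<bar>\<mu>\<bar> y i \<le> \<alpha> d(i) y i + (1 - \<alpha>) (\<Sum>j\<sim>i. y j)\<close> on the shadow graph, in which two
  vertices are adjacent if some edge contains both and \<open>d\<close> is the degree. Squaring it by convexity,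
  applying Cauchy-Schwarz and summing over \<open>i\<close> leaves two bounds to prove for every vertex \<open>v\<close>:
  \<open>d(v) \<le> n - 1\<close>, and at most \<open>T (n - 1)\<close> walks \<open>v, u, w\<close> of length two, where
  \<open>T = (6 k\<^sup>2 - 15 k + 10) (s - 1) / 2\<close>.

  Without a Berge book, adjacent vertices have at most \<open>m = (s - 1) (2 k - 3)\<close> common neighbours outside
  their edge; this bounds the walks ending in \<open>v\<close> or in a neighbour of \<open>v\<close>. For the other end points
  \<open>w\<close>, a walk is bad if the edge through \<open>v, u\<close> or the one through \<open>w, u\<close> contains a further common
  neighbour \<open>u'\<close>. A bad walk exhibits an outer common neighbour of an adjacent pair, so the number of bad
  walks is \<open>O(d(v) k m)\<close>. With \<open>t\<close> good common neighbours, \<open>v\<close> and \<open>w\<close> would span a Berge \<open>K\<^sub>2\<^sub>,\<^sub>t\<close>, so there are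
  at most \<open>t - 1 \<le> T\<close> of them. The total is at most \<open>T d(v) + T (n - 1 - d(v))\<close>.
\<close>

section \<open>Berge copies\<close>

text \<open>Under \<open>separated\<close> no hyperedge contains the images of two edges, so any
  choice of a hyperedge for each edge is injective and no system of distinct representatives has to
  be found.\<close>

lemma contains_bergeI:
  assumes "inj_on h VG" "h ` VG \<subseteq> V" "\<And>f. f \<in> E \<Longrightarrow> f \<subseteq> V"
    and edge: "\<And>e. e \<in> EG \<Longrightarrow> \<exists>f\<in>E. h ` e \<subseteq> f"
    and separated: "\<And>e e' f. e \<in> EG \<Longrightarrow> e' \<in> EG \<Longrightarrow> f \<in> E \<Longrightarrow> h ` e \<subseteq> f \<Longrightarrow> h ` e' \<subseteq> f \<Longrightarrow> e = e'"
  shows "contains_berge VG EG V E"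
proof -
  obtain \<phi> where \<phi>: "\<And>e. e \<in> EG \<Longrightarrow> \<phi> e \<in> E \<and> h ` e \<subseteq> \<phi> e"
    using edge by metis
  have "inj_on \<phi> EG"
    using \<phi> separated by (metis inj_onI)
  then have "is_berge VG EG V (\<phi> ` EG)"
    unfolding is_berge_def using assms(1,2) \<phi> by (intro exI[of _ h] exI[of _ \<phi>]) (auto simp: bij_betw_def)
  then show ?thesis
    unfolding contains_berge_def using \<phi> assms(3)
    by (intro exI[of _ V] exI[of _ "\<phi> ` EG"]) auto
qed

definition common_edge :: "'a set set \<Rightarrow> 'a \<Rightarrow> 'a \<Rightarrow> 'a \<Rightarrow> bool" where
  "common_edge E a b c \<longleftrightarrow> (\<exists>e\<in>E. a \<in> e \<and> b \<in> e \<and> c \<in> e)"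

definition shadow_nbrs :: "'a set set \<Rightarrow> 'a \<Rightarrow> 'a set" where
  "shadow_nbrs E v = {w. hyper_adjacent E v w}"

definition third_verts :: "'a set set \<Rightarrow> 'a \<Rightarrow> 'a \<Rightarrow> 'a set" where
  "third_verts E a b = {c. c \<noteq> a \<and> c \<noteq> b \<and> common_edge E a b c}"

text \<open>In a linear hypergraph, adjacent \<open>a\<close> and \<open>b\<close> lie on a unique
  edge and this keeps the common neighbours off that edge; for distinct non-adjacent
  \<open>a\<close> and \<open>b\<close> it keeps all common neighbours. One notion thus serves both
  forbidden graphs.\<close>

definition outer_nbrs :: "'a set set \<Rightarrow> 'a \<Rightarrow> 'a \<Rightarrow> 'a set" where
  "outer_nbrs E a b = {c \<in> shadow_nbrs E a \<inter> shadow_nbrs E b. \<not> common_edge E a b c}"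

text \<open>This makes the hyperedges joining \<open>a\<close> and \<open>b\<close> to the members
  of \<open>M\<close> pairwise different: two at the same centre by the second condition, two at
  different centres because \<open>M\<close> is outer.\<close>

definition separated_nbrs :: "'a set set \<Rightarrow> 'a \<Rightarrow> 'a \<Rightarrow> 'a set \<Rightarrow> bool" where
  "separated_nbrs E a b M \<longleftrightarrow> M \<subseteq> outer_nbrs E a b \<and>
     (\<forall>c\<in>M. \<forall>d\<in>M. c \<noteq> d \<longrightarrow> \<not> common_edge E a c d \<and> \<not> common_edge E b c d)"

lemma shadow_nbrs_sym: "u \<in> shadow_nbrs E v \<longleftrightarrow> v \<in> shadow_nbrs E u"
  unfolding shadow_nbrs_def hyper_adjacent_def by blast

lemma common_edge_commute: "common_edge E a b c \<longleftrightarrow> common_edge E a c b"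
  unfolding common_edge_def by blast

lemma common_edge_imp_shadow:
  "common_edge E a b c \<Longrightarrow> a \<noteq> b \<Longrightarrow> b \<in> shadow_nbrs E a"
  by (auto simp: common_edge_def shadow_nbrs_def hyper_adjacent_def)

lemma book_edges_eq: "book_edges s = insert {0, 1} (K2_edges s)"
  by (simp add: book_edges_def K2_edges_def)

text \<open>The labelling follows \<open>K2_verts\<close> and \<open>book_verts\<close>: 0 and 1 are
  the centres, labels from 2 on are the common neighbours.\<close>

lemma enumerate_separated_nbrs:
  assumes "finite M" "card M = r" "a \<noteq> b" "a \<notin> M" "b \<notin> M"
  obtains h :: "nat \<Rightarrow> 'a" where "inj_on h {..<r + 2}" "h 0 = a" "h 1 = b"
    "\<And>i. i \<in> {2..<r + 2} \<Longrightarrow> h i \<in> M"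
proof -
  obtain g :: "nat \<Rightarrow> 'a" where g: "bij_betw g {0..<r} M"
    using assms ex_bij_betw_nat_finite by blast
  define h where "h i = (if i = 0 then a else if i = 1 then b else g (i - 2))" for i :: nat
  have gM: "g i \<in> M" if "i < r" for i
    using g that by (auto simp: bij_betw_def)
  have hM: "h i \<in> M" if "i \<in> {2..<r + 2}" for i
    using that gM by (auto simp: h_def)
  have "i = j" if ij: "i < r + 2" "j < r + 2" "h i = h j" for i j
  proof -
    consider "i < 2" "j < 2" | "i < 2" "j \<ge> 2" | "i \<ge> 2" "j < 2" | "i \<ge> 2" "j \<ge> 2" by linarith
    then show ?thesis
    proof cases
      case 1
      with ij assms(3) show ?thesis by (auto simp: h_def less_2_cases_iff split: if_splits)
    next
      case 2
      with hM[of j] ij assms(4,5) show ?thesis by (auto simp: h_def less_2_cases_iff)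
    next
      case 3
      with hM[of i] ij assms(4,5) show ?thesis by (auto simp: h_def less_2_cases_iff)
    next
      case 4
      then have "g (i - 2) = g (j - 2)" using ij by (simp add: h_def)
      then have "i - 2 = j - 2"
        using g ij 4 by (auto simp: bij_betw_def inj_on_def)
      with 4 show ?thesis by linarith
    qed
  qed
  then have "inj_on h {..<r + 2}" by (auto intro: inj_onI)
  with that[of h] hM show ?thesis by (simp add: h_def)
qed

section \<open>Neighbourhoods and Berge copies in linear uniform hypergraphs\<close>

locale linear_uniform_hypergraph =
  fixes k :: nat and V :: "'a set" and E :: "'a set set"
  assumes uniform: "uniform_hypergraph k V E" and linear: "linear_hypergraph E"
begin

lemma finite_V: "finite V"
  using uniform by (simp add: uniform_hypergraph_def)

lemma edge_subset: "e \<in> E \<Longrightarrow> e \<subseteq> V" and card_edge: "e \<in> E \<Longrightarrow> card e = k"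
  using uniform by (auto simp: uniform_hypergraph_def)

lemma finite_edge: "e \<in> E \<Longrightarrow> finite e"
  using edge_subset finite_V finite_subset by blast

lemma finite_E: "finite E"
  using finite_subset[of E "Pow V"] edge_subset finite_V by blast

lemma edge_unique:
  assumes "e \<in> E" "f \<in> E" "a \<noteq> b" "a \<in> e" "b \<in> e" "a \<in> f" "b \<in> f"
  shows "e = f"
proof (rule ccontr)
  assume "e \<noteq> f"
  then have "card (e \<inter> f) \<le> 1"
    using linear assms by (auto simp: linear_hypergraph_def)
  moreover have "card {a, b} \<le> card (e \<inter> f)"
    using assms finite_edge by (intro card_mono) auto
  ultimately show False using assms by simp
qed

lemma shadow_nbrs_subset: "shadow_nbrs E v \<subseteq> V - {v}"
  using edge_subset by (auto simp: shadow_nbrs_def hyper_adjacent_def)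

lemma finite_shadow_nbrs: "finite (shadow_nbrs E v)"
  using shadow_nbrs_subset finite_V by (metis finite_Diff finite_subset)

lemma finite_outer_nbrs: "finite (outer_nbrs E a b)"
  unfolding outer_nbrs_def using finite_shadow_nbrs by simp

lemma shadow_nbrs_eq: "shadow_nbrs E v = (\<Union>e\<in>{e \<in> E. v \<in> e}. e - {v})"
  by (auto simp: shadow_nbrs_def hyper_adjacent_def)

text \<open>By linearity the sets \<open>e - {v}\<close> for the edges \<open>e\<close> through
  \<open>v\<close> partition the neighbourhood of \<open>v\<close>.\<close>

lemma sum_shadow_nbrs:
  fixes f :: "'a \<Rightarrow> 'b::comm_monoid_add"
  shows "(\<Sum>u\<in>shadow_nbrs E v. f u) = (\<Sum>e\<in>{e \<in> E. v \<in> e}. \<Sum>u\<in>e - {v}. f u)"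
  unfolding shadow_nbrs_eq
proof (rule sum.UNION_disjoint)
  show "finite {e \<in> E. v \<in> e}" using finite_E by simp
  show "\<forall>e\<in>{e \<in> E. v \<in> e}. finite (e - {v})" using finite_edge by simp
  show "\<forall>e\<in>{e \<in> E. v \<in> e}. \<forall>f\<in>{e \<in> E. v \<in> e}. e \<noteq> f \<longrightarrow> (e - {v}) \<inter> (f - {v}) = {}"
    using edge_unique by blast
qed

lemma card_shadow_nbrs: "card (shadow_nbrs E v) = (k - 1) * hyper_degree E v"
proof -
  have "card (shadow_nbrs E v) = (\<Sum>e\<in>{e \<in> E. v \<in> e}. card (e - {v}))"
    using sum_shadow_nbrs[of "\<lambda>_. 1::nat" v] by simp
  also have "\<dots> = (\<Sum>e\<in>{e \<in> E. v \<in> e}. k - 1)"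
    by (rule sum.cong) (auto simp: card_edge)
  finally show ?thesis by (simp add: hyper_degree_def)
qed

lemma card_third_verts:
  assumes "b \<in> shadow_nbrs E a"
  shows "card (third_verts E a b) = k - 2" "finite (third_verts E a b)"
proof -
  obtain e where e: "e \<in> E" "a \<in> e" "b \<in> e" "a \<noteq> b"
    using assms by (auto simp: shadow_nbrs_def hyper_adjacent_def)
  have "third_verts E a b = e - {a, b}"
    using e edge_unique by (auto simp: third_verts_def common_edge_def)
  moreover have "card (e - {a, b}) = k - 2"
    using e card_edge finite_edge by (subst card_Diff_subset) auto
  ultimately show "card (third_verts E a b) = k - 2" "finite (third_verts E a b)"
    using e finite_edge by auto
qed

text \<open>The centres are \<open>a\<close> and \<open>b\<close>. When they are adjacent, their
  edge serves as the base of the book; it contains no vertex of \<open>M\<close>, so it differs from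
  all the other hyperedges.\<close>

lemma separated_nbrs_contains_berge:
  assumes ab: "a \<noteq> b" "a \<in> V" "b \<in> V" and M: "separated_nbrs E a b M" "r \<le> card M"
  shows "contains_berge (K2_verts r) (K2_edges r) V E"
    and "b \<in> shadow_nbrs E a \<Longrightarrow> contains_berge (book_verts r) (book_edges r) V E"
proof -
  obtain M' where M': "M' \<subseteq> M" "card M' = r" "finite M'"
    using M(2) obtain_subset_with_card_n by metis
  have sep: "M' \<subseteq> outer_nbrs E a b"
    "\<And>c d. c \<in> M' \<Longrightarrow> d \<in> M' \<Longrightarrow> c \<noteq> d \<Longrightarrow> \<not> common_edge E a c d \<and> \<not> common_edge E b c d"
    using M(1) M'(1) unfolding separated_nbrs_def by blast+
  have "a \<notin> M'" "b \<notin> M'"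
    using sep(1) by (auto simp: outer_nbrs_def shadow_nbrs_def hyper_adjacent_def)
  then obtain h :: "nat \<Rightarrow> 'a" where h: "inj_on h {..<r + 2}" "h 0 = a" "h 1 = b"
    "\<And>i. i \<in> {2..<r + 2} \<Longrightarrow> h i \<in> M'"
    using enumerate_separated_nbrs[OF M'(3,2) ab(1)] by metis
  have hout: "\<exists>f\<in>E. {a, h i} \<subseteq> f" "\<exists>f\<in>E. {b, h i} \<subseteq> f" "\<And>f. f \<in> E \<Longrightarrow> {a, b, h i} \<subseteq> f \<Longrightarrow> False"
    "h i \<in> V"
    if "i \<in> {2..<r + 2}" for i
    using h(4)[OF that] sep(1) edge_subset
    by (auto simp: outer_nbrs_def shadow_nbrs_def hyper_adjacent_def common_edge_def)
  have hh: "i = j" if "i \<in> {2..<r + 2}" "j \<in> {2..<r + 2}" "f \<in> E"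
    "{a, h i, h j} \<subseteq> f \<or> {b, h i, h j} \<subseteq> f" for i j f
  proof -
    have "h i = h j"
      using sep(2)[OF h(4)[OF that(1)] h(4)[OF that(2)]] that(3,4) by (auto simp: common_edge_def)
    with h(1) that(1,2) show ?thesis by (auto simp: inj_on_def)
  qed
  have hV: "h ` {..<r + 2} \<subseteq> V"
  proof
    fix x assume "x \<in> h ` {..<r + 2}"
    then obtain i where i: "i < r + 2" "x = h i" by auto
    consider "i = 0" | "i = 1" | "i \<in> {2..<r + 2}" using i by fastforce
    then show "x \<in> V" using i ab h hout(4) by cases auto
  qed
  have edge: "\<exists>f\<in>E. h ` e \<subseteq> f" if "e \<in> K2_edges r" for e
    using that hout h(2,3) by (fastforce simp: K2_edges_def)
  have mem: "\<exists>i\<in>{2..<r + 2}. h i \<in> f \<and> (e = {0, i} \<and> a \<in> f \<or> e = {1, i} \<and> b \<in> f)"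
    if e: "e \<in> K2_edges r" "h ` e \<subseteq> f" for e f
  proof -
    obtain i where i: "i \<in> {2..<r + 2}" "e = {0, i} \<or> e = {1, i}"
      using e(1) unfolding K2_edges_def by blast
    have "h i \<in> f" "e = {0, i} \<Longrightarrow> a \<in> f" "e = {1, i} \<Longrightarrow> b \<in> f"
      using i(2) e(2) h(2,3) by auto
    with i show ?thesis by blast
  qed
  have separated: "e = e'" if e: "e \<in> K2_edges r" "e' \<in> K2_edges r"
    and f: "f \<in> E" "h ` e \<subseteq> f" "h ` e' \<subseteq> f" for e e' f
  proof -
    obtain i where i: "i \<in> {2..<r + 2}" "h i \<in> f" "e = {0, i} \<and> a \<in> f \<or> e = {1, i} \<and> b \<in> f"
      using mem[OF e(1) f(2)] by blast
    obtain j where j: "j \<in> {2..<r + 2}" "h j \<in> f" "e' = {0, j} \<and> a \<in> f \<or> e' = {1, j} \<and> b \<in> f"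
      using mem[OF e(2) f(3)] by blast
    \<comment> \<open>With different centres, \<open>f\<close> would contain \<open>a\<close>,
      \<open>b\<close> and \<open>h i\<close>, which \<open>hout(3)\<close> excludes; with the same
      centre, \<open>hh\<close> gives \<open>i = j\<close>.\<close>
    show ?thesis
      using i(2,3) j(2,3) hout(3)[OF i(1) f(1)] hh[OF i(1) j(1) f(1)] by blast
  qed
  show "contains_berge (K2_verts r) (K2_edges r) V E"
    unfolding K2_verts_def
    using h(1) hV edge_subset edge separated by (rule contains_bergeI)
  assume "b \<in> shadow_nbrs E a"
  then have base: "\<exists>f\<in>E. h ` {0, 1} \<subseteq> f"
    using h(2,3) by (auto simp: shadow_nbrs_def hyper_adjacent_def)
  have base_sep: False if "e \<in> K2_edges r" "f \<in> E" "h ` e \<subseteq> f" "h ` {0, 1} \<subseteq> f" for e f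
  proof -
    have "a \<in> f" "b \<in> f" using that(4) h(2,3) by auto
    with mem[OF that(1,3)] hout(3) that(2) show False by blast
  qed
  show "contains_berge (book_verts r) (book_edges r) V E"
    unfolding book_verts_def book_edges_eq
  proof (rule contains_bergeI[OF h(1) hV edge_subset])
    show "\<exists>f\<in>E. h ` e \<subseteq> f" if "e \<in> insert {0, 1} (K2_edges r)" for e
      using that base edge by blast
    show "e = e'" if "e \<in> insert {0, 1} (K2_edges r)" "e' \<in> insert {0, 1} (K2_edges r)" "f \<in> E"
      "h ` e \<subseteq> f" "h ` e' \<subseteq> f" for e e' f
      using that base_sep separated by blast
  qed
qed

section \<open>Counting walks of length two in the shadow graph\<close>

text \<open>A maximal separated set \<open>M\<close> has fewer than \<open>s\<close> elements, and each outer neighbour lies on one of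
  the two edges joining some \<open>c \<in> M\<close> to \<open>a\<close> and \<open>b\<close>.\<close>

lemma card_outer_nbrs_le:
  assumes "\<not> contains_berge (book_verts s) (book_edges s) V E" and ab: "b \<in> shadow_nbrs E a"
    and "k \<ge> 2"
  shows "card (outer_nbrs E a b) \<le> (s - 1) * (2 * k - 3)"
proof -
  let ?X = "outer_nbrs E a b"
  have abV: "a \<noteq> b" "a \<in> V" "b \<in> V"
    using ab edge_subset by (auto simp: shadow_nbrs_def hyper_adjacent_def)
  have small: "card M < s" if "separated_nbrs E a b M" for M
    using separated_nbrs_contains_berge(2)[OF abV that _ ab, of s] assms(1) by (meson not_le)
  have "separated_nbrs E a b {}" by (simp add: separated_nbrs_def)
  then obtain M where M: "separated_nbrs E a b M"
    and max: "\<And>M'. separated_nbrs E a b M' \<Longrightarrow> card M' \<le> card M"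
    using small ex_has_greatest_nat[of "separated_nbrs E a b" "{}" card s] by (metis less_imp_le)
  have MX: "M \<subseteq> ?X" using M by (simp add: separated_nbrs_def)
  then have finM: "finite M" using finite_outer_nbrs finite_subset by blast
  have cover: "?X \<subseteq> (\<Union>c\<in>M. insert c (third_verts E a c \<union> third_verts E b c))"
  proof
    fix d assume d: "d \<in> ?X"
    show "d \<in> (\<Union>c\<in>M. insert c (third_verts E a c \<union> third_verts E b c))"
    proof (cases "d \<in> M")
      case False
      \<comment> \<open>As \<open>d\<close> is itself an outer neighbour, the failure must come from
        a pair of \<open>d\<close> and some \<open>c\<close> in \<open>M\<close>.\<close>
      then have "\<not> separated_nbrs E a b (insert d M)"
        using max[of "insert d M"] finM by auto
      then obtain c where "c \<in> M" "common_edge E a c d \<or> common_edge E b c d"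
        using M d unfolding separated_nbrs_def by (auto simp: common_edge_commute)
      moreover have "d \<noteq> a" "d \<noteq> b"
        using d by (auto simp: outer_nbrs_def shadow_nbrs_def hyper_adjacent_def)
      ultimately show ?thesis by (auto simp: third_verts_def)
    qed auto
  qed
  \<comment> \<open>One for \<open>c\<close>, and \<open>k - 2\<close> further vertices on each of
    the edges through \<open>a, c\<close> and \<open>b, c\<close>.\<close>
  have each: "card (insert c (third_verts E a c \<union> third_verts E b c)) \<le> 2 * k - 3" if "c \<in> M" for c
  proof -
    have c: "c \<in> shadow_nbrs E a" "c \<in> shadow_nbrs E b"
      using MX that by (auto simp: outer_nbrs_def)
    have "card (insert c (third_verts E a c \<union> third_verts E b c))
        \<le> Suc (card (third_verts E a c \<union> third_verts E b c))"
      by (rule card_insert_le_m1) auto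
    also have "\<dots> \<le> Suc ((k - 2) + (k - 2))"
      using card_Un_le[of "third_verts E a c" "third_verts E b c"]
      by (simp add: card_third_verts[OF c(1)] card_third_verts[OF c(2)])
    also have "\<dots> = 2 * k - 3" using assms(3) by linarith
    finally show ?thesis .
  qed
  have "card ?X \<le> card (\<Union>c\<in>M. insert c (third_verts E a c \<union> third_verts E b c))"
    using cover finM card_third_verts(2) MX by (intro card_mono) (auto simp: outer_nbrs_def)
  also have "\<dots> \<le> (\<Sum>c\<in>M. card (insert c (third_verts E a c \<union> third_verts E b c)))"
    using finM by (rule card_UN_le)
  also have "\<dots> \<le> card M * (2 * k - 3)"
    using sum_bounded_above[of M, OF each] by simp
  also have "\<dots> \<le> (s - 1) * (2 * k - 3)"
    using small[OF M] by (intro mult_right_mono) auto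
  finally show ?thesis .
qed

text \<open>Walks \<open>v, u, w\<close> are recorded as pairs \<open>(u, w)\<close> and covered by
  four sets: \<open>A\<close> for \<open>w\<close> equal or adjacent to \<open>v\<close>,
  \<open>B1\<close> and \<open>B2\<close> for bad walks, \<open>C\<close> for good ones. The factor
  2 avoids a division in \<open>nat\<close>, since \<open>P\<close> contains half of the ordered
  pairs.\<close>

lemma sum_card_shadow_nbrs_le:
  assumes no_book: "\<not> contains_berge (book_verts s) (book_edges s) V E"
    and no_K2: "\<not> contains_berge (K2_verts t) (K2_edges t) V E"
    and v: "v \<in> V" and k: "k \<ge> 2"
  defines "m \<equiv> (s - 1) * (2 * k - 3)" and "d \<equiv> card (shadow_nbrs E v)"
  shows "2 * (\<Sum>u\<in>shadow_nbrs E v. card (shadow_nbrs E u))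
    \<le> d * (2 * (k - 1) + 2 * m + 3 * (k - 2) * m) + 2 * ((t - 1) * (card V - 1 - d))"
proof -
  let ?N = "shadow_nbrs E"
  obtain g :: "'a \<Rightarrow> nat" where g: "inj_on g V"
    using finite_V finite_imp_inj_to_nat_seg by blast
  have out: "card (outer_nbrs E a b) \<le> m" if "b \<in> ?N a" for a b
    unfolding m_def using card_outer_nbrs_le[OF no_book that k] .
  \<comment> \<open>Ordering the pairs \<open>u, u'\<close> on an edge through \<open>v\<close> by \<open>g\<close> halves the count of \<open>B1\<close>; without the factor
    \<open>1 / 2\<close> the final constant would be too large.\<close>
  define A where "A = (SIGMA u:?N v. insert v (third_verts E v u \<union> outer_nbrs E v u))"
  define P where "P = {(u, u'). u \<in> ?N v \<and> u' \<in> third_verts E v u \<and> g u' < g u}"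
  \<comment> \<open>Bad at the edge through \<open>v, u\<close>: \<open>w\<close> is an outer
    neighbour of the adjacent pair \<open>u, u'\<close>.\<close>
  define B1 where "B1 = (\<Union>(u, u')\<in>P. {u} \<times> outer_nbrs E u u')"
  \<comment> \<open>Bad at the edge through \<open>w, u\<close>: \<open>u'\<close> on it is an outer
    neighbour of the pair \<open>v, u\<close>, and \<open>w\<close> is one of the
    \<open>k - 2\<close> other vertices of the edge through \<open>u, u'\<close>.\<close>
  define B2 where "B2 = (SIGMA u:?N v. \<Union>u'\<in>outer_nbrs E v u. third_verts E u u')"
  define W where "W = V - {v} - ?N v"
  \<comment> \<open>On the side of \<open>v\<close> only a \<open>u'\<close> with smaller
    \<open>g\<close> disqualifies \<open>u\<close>. This still separates: of two common neighbours
    on an edge through \<open>v\<close>, the one with the larger \<open>g\<close> is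
    rejected.\<close>
  define good where "good w = {u \<in> ?N v \<inter> ?N w.
      (\<forall>u'\<in>third_verts E v u. g u' < g u \<longrightarrow> u' \<notin> ?N w) \<and>
      (\<forall>u'\<in>?N v. u' \<noteq> u \<longrightarrow> \<not> common_edge E w u u')}" for w
  define C where "C = (\<Union>w\<in>W. good w \<times> {w})"

  have cardA: "card A \<le> d * ((k - 1) + m)"
  proof -
    have "card (insert v (third_verts E v u \<union> outer_nbrs E v u)) \<le> (k - 1) + m" if u: "u \<in> ?N v" for u
    proof -
      have "card (insert v (third_verts E v u \<union> outer_nbrs E v u))
          \<le> Suc (card (third_verts E v u \<union> outer_nbrs E v u))"
        by (rule card_insert_le_m1) auto
      also have "\<dots> \<le> Suc ((k - 2) + m)"
        using card_Un_le[of "third_verts E v u" "outer_nbrs E v u"] out[OF u]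
        by (simp add: card_third_verts[OF u])
      finally show ?thesis using k by linarith
    qed
    then have "(\<Sum>u\<in>?N v. card (insert v (third_verts E v u \<union> outer_nbrs E v u))) \<le> (\<Sum>u\<in>?N v. (k - 1) + m)"
      by (rule sum_mono)
    then show ?thesis
      unfolding A_def using finite_shadow_nbrs card_third_verts(2) finite_outer_nbrs
      by (subst card_SigmaI) (auto simp: d_def)
  qed

  have third_sym: "u' \<in> third_verts E v u \<longleftrightarrow> u \<in> third_verts E v u'"
    if "u \<in> ?N v" "u' \<in> ?N v" for u u'
    using that by (auto simp: third_verts_def common_edge_def shadow_nbrs_def hyper_adjacent_def)
  have third_N: "u' \<in> ?N v" if "u' \<in> third_verts E v u" for u u'
    using that by (auto simp: third_verts_def common_edge_def shadow_nbrs_def hyper_adjacent_def)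
  have finQ: "finite (SIGMA u:?N v. third_verts E v u)"
    using finite_shadow_nbrs card_third_verts(2) by auto
  have cardP: "2 * card P = d * (k - 2)" and finP: "finite P"
  proof -
    let ?Q = "SIGMA u:?N v. third_verts E v u"
    show finP: "finite P"
      using finQ by (rule finite_subset[rotated]) (auto simp: P_def)
    have gne: "g u \<noteq> g u'" if "u \<in> ?N v" "u' \<in> third_verts E v u" for u u'
    proof -
      have "u \<in> V" "u' \<in> V" "u \<noteq> u'"
        using that third_N[OF that(2)] shadow_nbrs_subset by (auto simp: third_verts_def)
      then show ?thesis using g by (auto simp: inj_on_def)
    qed
    \<comment> \<open>Since \<open>g\<close> is injective on \<open>V\<close>, exactly one of the
      two orders of each pair lies in \<open>P\<close>.\<close>
    have "?Q = P \<union> prod.swap ` P"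
    proof (intro set_eqI iffI)
      fix p assume "p \<in> ?Q"
      then obtain u u' where p: "p = (u, u')" "u \<in> ?N v" "u' \<in> third_verts E v u" by auto
      then have "g u < g u' \<or> g u' < g u" using gne by (meson linorder_neqE_nat)
      then show "p \<in> P \<union> prod.swap ` P"
      proof
        assume "g u < g u'"
        then have "(u', u) \<in> P"
          using p third_N third_sym by (auto simp: P_def)
        then have "prod.swap (u', u) \<in> prod.swap ` P" by (rule imageI)
        then show ?thesis using p by simp
      next
        assume "g u' < g u"
        then show ?thesis using p by (auto simp: P_def)
      qed
    next
      fix p assume "p \<in> P \<union> prod.swap ` P"
      then obtain q where "p = q \<or> p = prod.swap q" "q \<in> P" by blast
      moreover obtain u u' where "q = (u, u')" by (cases q)
      ultimately have "p = (u, u') \<or> p = (u', u)" "(u, u') \<in> P" by auto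
      then show "p \<in> ?Q" using third_N third_sym unfolding P_def by blast
    qed
    moreover have "P \<inter> prod.swap ` P = {}" by (auto simp: P_def)
    moreover have "card (prod.swap ` P) = card P" by (intro card_image) auto
    ultimately have "card ?Q = 2 * card P"
      using finP by (simp add: card_Un_disjoint)
    moreover have "card ?Q = d * (k - 2)"
      using finite_shadow_nbrs card_third_verts by (simp add: d_def)
    ultimately show "2 * card P = d * (k - 2)" by simp
  qed

  have cardB1: "2 * card B1 \<le> d * (k - 2) * m"
  proof -
    have "card B1 \<le> (\<Sum>p\<in>P. card (case p of (u, u') \<Rightarrow> {u} \<times> outer_nbrs E u u'))"
      unfolding B1_def using finP by (rule card_UN_le)
    also have "\<dots> \<le> (\<Sum>p\<in>P. m)"
    proof (rule sum_mono)
      fix p assume "p \<in> P"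
      then obtain u u' where p: "p = (u, u')" "u \<in> ?N v" "u' \<in> third_verts E v u"
        by (auto simp: P_def)
      then have "u' \<in> ?N u"
        by (auto simp: third_verts_def common_edge_def shadow_nbrs_def hyper_adjacent_def)
      with out p show "card (case p of (u, u') \<Rightarrow> {u} \<times> outer_nbrs E u u') \<le> m"
        by (simp add: card_cartesian_product)
    qed
    finally have "card B1 \<le> card P * m" by simp
    then have "2 * card B1 \<le> (2 * card P) * m" by simp
    then show ?thesis unfolding cardP .
  qed

  have outer_N: "u' \<in> ?N u" if "u' \<in> outer_nbrs E v u" for u u'
    using that by (auto simp: outer_nbrs_def)
  have cardB2: "card B2 \<le> d * (m * (k - 2))"
  proof -
    have "card (\<Union>u'\<in>outer_nbrs E v u. third_verts E u u') \<le> m * (k - 2)" if u: "u \<in> ?N v" for u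
    proof -
      have "card (\<Union>u'\<in>outer_nbrs E v u. third_verts E u u') \<le> (\<Sum>u'\<in>outer_nbrs E v u. card (third_verts E u u'))"
        using finite_outer_nbrs by (rule card_UN_le)
      also have "\<dots> = card (outer_nbrs E v u) * (k - 2)"
        using card_third_verts(1)[OF outer_N] by simp
      also have "\<dots> \<le> m * (k - 2)" using out[OF u] by simp
      finally show ?thesis .
    qed
    then have "(\<Sum>u\<in>?N v. card (\<Union>u'\<in>outer_nbrs E v u. third_verts E u u')) \<le> (\<Sum>u\<in>?N v. m * (k - 2))"
      by (rule sum_mono)
    then show ?thesis
      unfolding B2_def using finite_shadow_nbrs card_third_verts(2)[OF outer_N] finite_outer_nbrs
      by (subst card_SigmaI) (auto simp: d_def)
  qed

  have finW: "finite W" using finite_V by (simp add: W_def)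
  have cardW: "card W = card V - 1 - d"
    unfolding W_def d_def using v shadow_nbrs_subset[of v] finite_V finite_shadow_nbrs
    by (subst card_Diff_subset) auto
  have cardgood: "card (good w) \<le> t - 1" if w: "w \<in> W" for w
  proof -
    have nadj: "\<not> common_edge E v w c" for c
      using w common_edge_imp_shadow[of E v w c] by (auto simp: W_def)
    have "separated_nbrs E v w (good w)"
      unfolding separated_nbrs_def
    proof (intro conjI ballI impI)
      show "good w \<subseteq> outer_nbrs E v w"
        using nadj by (auto simp: good_def outer_nbrs_def)
      fix a b assume ab: "a \<in> good w" "b \<in> good w" "a \<noteq> b"
      then have N: "a \<in> ?N v" "b \<in> ?N v" "a \<in> ?N w" "b \<in> ?N w" by (auto simp: good_def)
      have sep: "\<not> common_edge E w c u'" if "c \<in> good w" "u' \<in> ?N v" "u' \<noteq> c" for c u'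
        using that by (simp add: good_def)
      show "\<not> common_edge E w a b" using sep[OF ab(1) N(2)] ab(3) by simp
      show "\<not> common_edge E v a b"
      proof
        assume c: "common_edge E v a b"
        have "g a \<noteq> g b"
          using g N ab(3) shadow_nbrs_subset by (meson DiffD1 inj_onD subsetD)
        moreover have "b \<in> third_verts E v a" "a \<in> third_verts E v b"
          using c ab(3) N by (auto simp: third_verts_def common_edge_def shadow_nbrs_def hyper_adjacent_def)
        moreover have "\<not> g u' < g c" if "c \<in> good w" "u' \<in> third_verts E v c" "u' \<in> ?N w" for c u'
          using that by (auto simp: good_def)
        ultimately show False using ab(1,2) N(3,4) by (meson linorder_neqE_nat)
      qed
    qed
    moreover have "v \<noteq> w" "w \<in> V" using w by (auto simp: W_def)
    ultimately have "\<not> t \<le> card (good w)"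
      using separated_nbrs_contains_berge(1) v no_K2 by blast
    then show ?thesis by linarith
  qed
  have cardC: "card C \<le> (t - 1) * (card V - 1 - d)"
  proof -
    have "card C \<le> (\<Sum>w\<in>W. card (good w \<times> {w}))"
      unfolding C_def using finW by (rule card_UN_le)
    also have "\<dots> \<le> (\<Sum>w\<in>W. t - 1)"
      using cardgood by (intro sum_mono) (simp add: card_cartesian_product)
    finally show ?thesis by (simp add: cardW mult.commute)
  qed

  have cover: "(SIGMA u:?N v. ?N u) \<subseteq> A \<union> B1 \<union> B2 \<union> C"
  proof
    fix p assume "p \<in> (SIGMA u:?N v. ?N u)"
    then obtain u w where p: "p = (u, w)" and u: "u \<in> ?N v" and w: "w \<in> ?N u" by auto
    have uw: "u \<in> ?N w" "v \<noteq> u" "w \<noteq> u" "w \<in> V"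
      using u w edge_subset by (auto simp: shadow_nbrs_def hyper_adjacent_def)
    consider "w = v" | "w \<in> ?N v" | "w \<in> W" using uw(4) by (auto simp: W_def)
    then show "p \<in> A \<union> B1 \<union> B2 \<union> C"
    proof cases
      case 1
      then show ?thesis using p u by (auto simp: A_def)
    next
      case 2
      then have "w \<noteq> v" by (auto simp: shadow_nbrs_def hyper_adjacent_def)
      then have "w \<in> third_verts E v u \<union> outer_nbrs E v u"
        using 2 w uw by (auto simp: third_verts_def outer_nbrs_def)
      then show ?thesis using p u by (auto simp: A_def)
    next
      case 3
      then have wv: "w \<noteq> v" "w \<notin> ?N v" by (auto simp: W_def)
      have nadj: "\<not> common_edge E v w c" for c
        using wv common_edge_imp_shadow by metis
      show ?thesis
      proof (cases "u \<in> good w")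
        case True
        then show ?thesis using p 3 by (auto simp: C_def)
      next
        case False
        then consider u' where "u' \<in> third_verts E v u" "g u' < g u" "u' \<in> ?N w"
          | u' where "u' \<in> ?N v" "u' \<noteq> u" "common_edge E w u u'"
          using u uw(1) by (auto simp: good_def)
        then show ?thesis
        proof cases
          case 1
          have "u \<noteq> u'" "common_edge E u u' v"
            using 1(1) by (auto simp: third_verts_def common_edge_def)
          \<comment> \<open>An edge through \<open>u, u', w\<close> would be the edge through
            \<open>u, u'\<close>, which contains \<open>v\<close>; but \<open>v\<close> and
            \<open>w\<close> are not adjacent.\<close>
          then have "\<not> common_edge E u u' w"
            using edge_unique nadj unfolding common_edge_def by blast
          then have "w \<in> outer_nbrs E u u'"
            using w 1(3) by (simp add: outer_nbrs_def shadow_nbrs_sym[of w])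
          then show ?thesis using p u 1 by (auto simp: B1_def P_def)
        next
          case 2
          \<comment> \<open>An edge through \<open>v, u, u'\<close> would coincide with the one
            through \<open>w, u, u'\<close> and join \<open>v\<close> to \<open>w\<close>.\<close>
          have "\<not> common_edge E v u u'"
            using edge_unique nadj 2(2,3) unfolding common_edge_def by blast
          moreover have "u' \<in> ?N u"
            using 2 by (auto simp: common_edge_def shadow_nbrs_def hyper_adjacent_def)
          ultimately have "u' \<in> outer_nbrs E v u" using 2 by (simp add: outer_nbrs_def)
          moreover have "w \<in> third_verts E u u'"
            using 2 wv uw by (auto simp: third_verts_def common_edge_def)
          ultimately show ?thesis using p u by (auto simp: B2_def)
        qed
      qed
    qed
  qed
  have finA: "finite A"
    unfolding A_def using finite_shadow_nbrs card_third_verts(2) finite_outer_nbrs by auto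
  have finB1: "finite B1"
    unfolding B1_def using finP finite_outer_nbrs by auto
  have finB2: "finite B2"
    unfolding B2_def using finite_shadow_nbrs card_third_verts(2)[OF outer_N] finite_outer_nbrs by auto
  have finC: "finite C"
    unfolding C_def good_def using finW finite_shadow_nbrs by auto
  have "(\<Sum>u\<in>?N v. card (?N u)) = card (SIGMA u:?N v. ?N u)"
    using finite_shadow_nbrs by simp
  also have "\<dots> \<le> card (A \<union> B1 \<union> B2 \<union> C)"
    using cover finA finB1 finB2 finC by (intro card_mono) auto
  also have "\<dots> \<le> card A + card B1 + card B2 + card C"
    by (intro order_trans[OF card_Un_le] add_mono order_refl)
  finally have "2 * (\<Sum>u\<in>?N v. card (?N u)) \<le> 2 * card A + 2 * card B1 + 2 * card B2 + 2 * card C"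
    by simp
  \<comment> \<open>After doubling, \<open>B1\<close> contributes \<open>d * (k - 2) * m\<close> and
    \<open>B2\<close> twice that, which explains the coefficient 3.\<close>
  also have "\<dots> \<le> 2 * (d * ((k - 1) + m)) + d * (k - 2) * m + 2 * (d * (m * (k - 2)))
      + 2 * ((t - 1) * (card V - 1 - d))"
    using cardA cardB1 cardB2 cardC by (intro add_mono mult_left_mono) auto
  also have "\<dots> = d * (2 * (k - 1) + 2 * m + 3 * (k - 2) * m) + 2 * ((t - 1) * (card V - 1 - d))"
    by (simp add: algebra_simps)
  finally show ?thesis .
qed

end

section \<open>From the tensor to the shadow graph\<close>

text \<open>AM-GM for the numbers \<open>f i ^ card S\<close>, whose geometric mean is the product
  of the \<open>f i\<close>.\<close>

lemma prod_le_mean_power: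
  fixes f :: "'a \<Rightarrow> real"
  assumes "finite S" "S \<noteq> {}" "\<And>i. i \<in> S \<Longrightarrow> f i \<ge> 0"
  shows "(\<Prod>i\<in>S. f i) \<le> (\<Sum>i\<in>S. f i ^ card S) / card S"
proof -
  have c: "card S > 0" using assms by (simp add: card_gt_0_iff)
  have "(\<Prod>i\<in>S. f i) = ((\<Prod>i\<in>S. f i) ^ card S) powr (1 / card S)"
    using c assms prod_nonneg[of S f]
    \<comment> \<open>A zero product is treated apart because \<open>powr_realpow\<close> needs a
      positive base.\<close>
    by (cases "(\<Prod>i\<in>S. f i) = 0") (auto simp: powr_realpow[symmetric] powr_powr simp del: prod_zero_iff)
  also have "\<dots> = (\<Prod>i\<in>S. f i ^ card S) powr (1 / card S)"
    by (simp add: prod_power_distrib)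
  also have "\<dots> \<le> (\<Sum>i\<in>S. f i ^ card S / card S)"
    using assms by (intro arith_geom_mean) auto
  finally show ?thesis by (simp add: sum_divide_distrib)
qed

text \<open>Only the constant list \<open>replicate (k - 1) i\<close> contributes.\<close>

lemma sum_degree_tensor:
  fixes f :: "'a \<Rightarrow> real"
  assumes "finite V" "i \<in> V" "k \<ge> 1"
  shows "(\<Sum>js\<in>{js. set js \<subseteq> V \<and> length js = k - 1}. degree_tensor k E (i # js) * prod_list (map f js))
    = real (hyper_degree E i) * f i ^ (k - 1)"
proof -
  let ?J = "{js. set js \<subseteq> V \<and> length js = k - 1}"
  obtain l where l: "k = Suc l" using assms(3) by (cases k) auto
  have "(\<Sum>js\<in>?J. degree_tensor k E (i # js) * prod_list (map f js))
      = (\<Sum>js\<in>?J. if js = replicate (k - 1) i then real (hyper_degree E i) * f i ^ (k - 1) else 0)"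
    by (rule sum.cong) (auto simp: degree_tensor_def l prod_list_replicate)
  also have "\<dots> = real (hyper_degree E i) * f i ^ (k - 1)"
    using assms finite_lists_length_eq[OF assms(1), of "k - 1"] by (subst sum.delta) auto
  finally show ?thesis .
qed

context linear_uniform_hypergraph
begin

text \<open>Each edge through \<open>i\<close> arises from the \<open>fact (k - 1)\<close> orderings
  of its other vertices, which cancels the weight \<open>1 / fact (k - 1)\<close>.\<close>

lemma sum_adjacency_tensor:
  fixes f :: "'a \<Rightarrow> real"
  assumes k: "k \<ge> 1"
  shows "(\<Sum>js\<in>{js. set js \<subseteq> V \<and> length js = k - 1}. adjacency_tensor k E (i # js) * prod_list (map f js))
    = (\<Sum>e\<in>{e \<in> E. i \<in> e}. \<Prod>j\<in>e - {i}. f j)"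
proof -
  let ?J = "{js. set js \<subseteq> V \<and> length js = k - 1}"
  let ?L = "\<Union>e\<in>{e \<in> E. i \<in> e}. permutations_of_set (e - {i})"
  let ?F = "\<lambda>js. adjacency_tensor k E (i # js) * prod_list (map f js)"
  have finJ: "finite ?J" using finite_lists_length_eq[OF finite_V, of "k - 1"] .
  have len: "length js = k - 1" if "e \<in> E" "i \<in> e" "js \<in> permutations_of_set (e - {i})" for e js
  proof -
    have js: "set js = e - {i}" "distinct js"
      using that(3) by (auto simp: permutations_of_set_def)
    have "length js = card (e - {i})"
      using distinct_card[OF js(2)] js(1) by simp
    then show ?thesis using that card_edge by simp
  qed
  have "?L \<subseteq> ?J"
  proof safe
    fix e js j assume "e \<in> E" "i \<in> e" "js \<in> permutations_of_set (e - {i})"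
    then show "length js = k - 1" and "j \<in> set js \<Longrightarrow> j \<in> V"
      using len edge_subset by (auto simp: permutations_of_set_def)
  qed
  moreover have "?F js = 0" if js: "js \<in> ?J - ?L" for js
  proof (rule ccontr)
    assume "?F js \<noteq> 0"
    then have e: "insert i (set js) \<in> E"
      by (auto simp: adjacency_tensor_def split: if_splits)
    then have "card (insert i (set js)) = k" by (rule card_edge)
    \<comment> \<open>An edge has \<open>k\<close> elements, so the list \<open>i # js\<close> of
      length \<open>k\<close> has no repetition.\<close>
    then have ce: "card (set (i # js)) = length (i # js)" using js k by simp
    then have "distinct (i # js)" by (rule card_distinct)
    then have "js \<in> permutations_of_set (insert i (set js) - {i})"
      by (auto simp: permutations_of_set_def)
    with e js show False by blast
  qed
  ultimately have "(\<Sum>js\<in>?J. ?F js) = (\<Sum>js\<in>?L. ?F js)"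
    using finJ by (intro sum.mono_neutral_right) auto
  also have "\<dots> = (\<Sum>e\<in>{e \<in> E. i \<in> e}. \<Sum>js\<in>permutations_of_set (e - {i}). ?F js)"
  proof (rule sum.UNION_disjoint)
    show "\<forall>e\<in>{e \<in> E. i \<in> e}. \<forall>e'\<in>{e \<in> E. i \<in> e}. e \<noteq> e' \<longrightarrow>
        permutations_of_set (e - {i}) \<inter> permutations_of_set (e' - {i}) = {}"
      by (auto simp: permutations_of_set_def)
  qed (use finite_E in auto)
  also have "\<dots> = (\<Sum>e\<in>{e \<in> E. i \<in> e}. \<Prod>j\<in>e - {i}. f j)"
  proof (rule sum.cong)
    fix e assume e: "e \<in> {e \<in> E. i \<in> e}"
    have F: "?F js = (\<Prod>j\<in>e - {i}. f j) / fact (k - 1)" if js: "js \<in> permutations_of_set (e - {i})" for js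
    proof -
      have "set js = e - {i}" "distinct js" using js by (auto simp: permutations_of_set_def)
      moreover from this have "insert i (set js) = e" using e by auto
      ultimately show ?thesis
        using e len[of e js] js k by (simp add: adjacency_tensor_def prod.distinct_set_conv_list[symmetric])
    qed
    have "card (e - {i}) = k - 1" "finite (e - {i})" using e card_edge finite_edge by auto
    then show "(\<Sum>js\<in>permutations_of_set (e - {i}). ?F js) = (\<Prod>j\<in>e - {i}. f j)"
      by (simp add: F)
  qed simp
  finally show ?thesis .
qed

text \<open>The triangle inequality applies because the tensor entries are nonnegative. AM-GM then
  replaces each product of \<open>k - 1\<close> factors by the mean of their powers
  \<open>y j\<close>, and multiplying by \<open>k - 1\<close> turns hypergraph degrees into shadow
  degrees.\<close>

lemma eigenvalue_shadow_inequality: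
  assumes k: "k \<ge> 2" and \<alpha>: "0 \<le> \<alpha>" "\<alpha> \<le> 1" and i: "i \<in> V"
    and eig: "tensor_apply k V (\<lambda>js. complex_of_real (alpha_tensor \<alpha> k E js)) x i = \<mu> * x i ^ (k - 1)"
  defines "y \<equiv> \<lambda>j. cmod (x j) ^ (k - 1)"
  shows "(real k - 1) * cmod \<mu> * y i
    \<le> \<alpha> * (real (card (shadow_nbrs E i)) * y i) + (1 - \<alpha>) * (\<Sum>j\<in>shadow_nbrs E i. y j)"
proof -
  let ?J = "{js. set js \<subseteq> V \<and> length js = k - 1}"
  let ?f = "\<lambda>j. cmod (x j)"
  have normp: "cmod (prod_list (map x js)) = prod_list (map ?f js)" for js
    by (induction js) (auto simp: norm_mult)
  have nonneg: "alpha_tensor \<alpha> k E js \<ge> 0" for js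
    using \<alpha> by (auto simp: alpha_tensor_def degree_tensor_def adjacency_tensor_def)
  have k1: "real (k - 1) = real k - 1" "k - 1 > 0" using k by auto
  have "cmod \<mu> * y i = cmod (\<Sum>js\<in>?J. complex_of_real (alpha_tensor \<alpha> k E (i # js)) * prod_list (map x js))"
    using arg_cong[OF eig, of cmod] by (simp add: y_def norm_mult norm_power tensor_apply_def)
  also have "\<dots> \<le> (\<Sum>js\<in>?J. alpha_tensor \<alpha> k E (i # js) * prod_list (map ?f js))"
    using nonneg by (intro sum_norm_le) (simp add: norm_mult normp)
  also have "\<dots> = \<alpha> * (\<Sum>js\<in>?J. degree_tensor k E (i # js) * prod_list (map ?f js))
      + (1 - \<alpha>) * (\<Sum>js\<in>?J. adjacency_tensor k E (i # js) * prod_list (map ?f js))"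
    by (simp add: alpha_tensor_def algebra_simps sum.distrib sum_distrib_left sum_subtractf)
  also have "\<dots> = \<alpha> * (real (hyper_degree E i) * y i) + (1 - \<alpha>) * (\<Sum>e\<in>{e \<in> E. i \<in> e}. \<Prod>j\<in>e - {i}. ?f j)"
    using k by (simp only: sum_degree_tensor[OF finite_V i] sum_adjacency_tensor y_def)
  also have "\<dots> \<le> \<alpha> * (real (hyper_degree E i) * y i)
      + (1 - \<alpha>) * (\<Sum>e\<in>{e \<in> E. i \<in> e}. (\<Sum>j\<in>e - {i}. y j) / (real k - 1))"
  proof (intro add_left_mono mult_left_mono sum_mono)
    fix e assume e: "e \<in> {e \<in> E. i \<in> e}"
    then have c: "card (e - {i}) = k - 1" "finite (e - {i})" using card_edge finite_edge by auto
    then have "e - {i} \<noteq> {}" using k1(2) by (metis card.empty less_irrefl)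
    then show "(\<Prod>j\<in>e - {i}. ?f j) \<le> (\<Sum>j\<in>e - {i}. y j) / (real k - 1)"
      using prod_le_mean_power[of "e - {i}" ?f] c k1(1) by (simp add: y_def)
  qed (use \<alpha> in simp)
  also have "\<dots> = \<alpha> * (real (hyper_degree E i) * y i) + (1 - \<alpha>) * ((\<Sum>j\<in>shadow_nbrs E i. y j) / (real k - 1))"
    by (simp add: sum_shadow_nbrs sum_divide_distrib)
  finally have "(real k - 1) * (cmod \<mu> * y i) \<le> (real k - 1) * (\<alpha> * (real (hyper_degree E i) * y i)
      + (1 - \<alpha>) * ((\<Sum>j\<in>shadow_nbrs E i. y j) / (real k - 1)))"
    using k by (intro mult_left_mono) auto
  also have "\<dots> = \<alpha> * ((real k - 1) * real (hyper_degree E i) * y i) + (1 - \<alpha>) * (\<Sum>j\<in>shadow_nbrs E i. y j)"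
    using k by (simp add: field_simps)
  also have "(real k - 1) * real (hyper_degree E i) = real (card (shadow_nbrs E i))"
    by (simp add: card_shadow_nbrs k1(1)[symmetric])
  finally show ?thesis by (simp add: mult.assoc)
qed

text \<open>Cauchy-Schwarz on each neighbourhood, then an exchange of sums by symmetry of adjacency.
  The inner sum on the right counts walks of length two from \<open>j\<close>.\<close>

lemma sum_square_shadow_nbrs_le:
  fixes y :: "'a \<Rightarrow> real"
  shows "(\<Sum>i\<in>V. (\<Sum>j\<in>shadow_nbrs E i. y j)\<^sup>2)
    \<le> (\<Sum>j\<in>V. (y j)\<^sup>2 * (\<Sum>i\<in>shadow_nbrs E j. real (card (shadow_nbrs E i))))"
proof -
  let ?N = "shadow_nbrs E"
  have restrict: "{u \<in> V. u \<in> ?N i} = ?N i" for i using shadow_nbrs_subset by blast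
  have "(\<Sum>i\<in>V. (\<Sum>j\<in>?N i. y j)\<^sup>2) \<le> (\<Sum>i\<in>V. \<Sum>j\<in>?N i. (y j)\<^sup>2 * card (?N i))"
    using sum_squared_le_sum_of_squares by (intro sum_mono) (auto simp: sum_distrib_right[symmetric])
  also have "\<dots> = (\<Sum>i\<in>V. \<Sum>j\<in>{j \<in> V. j \<in> ?N i}. (y j)\<^sup>2 * card (?N i))"
    by (simp add: restrict)
  also have "\<dots> = (\<Sum>j\<in>V. \<Sum>i\<in>{i \<in> V. j \<in> ?N i}. (y j)\<^sup>2 * card (?N i))"
    using finite_V by (rule sum.swap_restrict[OF _ finite_V])
  also have "\<dots> = (\<Sum>j\<in>V. (y j)\<^sup>2 * (\<Sum>i\<in>?N j. real (card (?N i))))"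
    by (subst shadow_nbrs_sym) (simp add: restrict sum_distrib_left)
  finally show ?thesis .
qed

text \<open>Convexity of the square separates the degree part from the neighbour part, so
  \<open>D\<close> and \<open>S\<close> enter independently. The sum of the
  \<open>(y i)\<^sup>2\<close> is positive and cancels at the end.\<close>

lemma eigenvalue_square_le:
  assumes k: "k \<ge> 2" and \<alpha>: "0 \<le> \<alpha>" "\<alpha> \<le> 1"
    and eig: "tensor_eigenvalue k V (\<lambda>js. complex_of_real (alpha_tensor \<alpha> k E js)) \<mu>"
    and D: "\<And>v. v \<in> V \<Longrightarrow> real (card (shadow_nbrs E v)) \<le> D"
    and S: "\<And>v. v \<in> V \<Longrightarrow> (\<Sum>u\<in>shadow_nbrs E v. real (card (shadow_nbrs E u))) \<le> S"
  shows "((real k - 1) * cmod \<mu>)\<^sup>2 \<le> \<alpha> * D\<^sup>2 + (1 - \<alpha>) * S"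
proof -
  let ?N = "shadow_nbrs E"
  let ?d = "\<lambda>i. real (card (?N i))"
  obtain x i0 where i0: "i0 \<in> V" "x i0 \<noteq> 0"
    and x: "\<forall>i\<in>V. tensor_apply k V (\<lambda>js. complex_of_real (alpha_tensor \<alpha> k E js)) x i = \<mu> * x i ^ (k - 1)"
    using eig by (auto simp: tensor_eigenvalue_def)
  define y where "y j = cmod (x j) ^ (k - 1)" for j
  let ?r = "(real k - 1) * cmod \<mu>"
  let ?Y = "\<Sum>i\<in>V. (y i)\<^sup>2"
  have pos: "?Y > 0"
    using i0 finite_V by (intro sum_pos2[of _ i0]) (auto simp: y_def)
  have pointwise: "?r\<^sup>2 * (y i)\<^sup>2 \<le> \<alpha> * (D\<^sup>2 * (y i)\<^sup>2) + (1 - \<alpha>) * (\<Sum>j\<in>?N i. y j)\<^sup>2" if i: "i \<in> V" for i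
  proof -
    have "?r\<^sup>2 * (y i)\<^sup>2 = (?r * y i)\<^sup>2" by (simp add: power_mult_distrib)
    also have "\<dots> \<le> (\<alpha> * (?d i * y i) + (1 - \<alpha>) * (\<Sum>j\<in>?N i. y j))\<^sup>2"
      using eigenvalue_shadow_inequality[OF k \<alpha> i x[rule_format, OF i]] k
      by (intro power_mono) (auto simp: y_def)
    also have "\<dots> \<le> \<alpha> * (?d i * y i)\<^sup>2 + (1 - \<alpha>) * (\<Sum>j\<in>?N i. y j)\<^sup>2"
      using convex_onD[OF convex_power2, of \<alpha> "\<Sum>j\<in>?N i. y j" "?d i * y i"] \<alpha> by (simp add: algebra_simps)
    also have "\<dots> \<le> \<alpha> * (D\<^sup>2 * (y i)\<^sup>2) + (1 - \<alpha>) * (\<Sum>j\<in>?N i. y j)\<^sup>2"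
      using \<alpha> D[OF i] by (intro add_right_mono mult_left_mono) (auto simp: power_mult_distrib intro!: mult_right_mono power_mono)
    finally show ?thesis .
  qed
  have "?r\<^sup>2 * ?Y \<le> (\<Sum>i\<in>V. \<alpha> * (D\<^sup>2 * (y i)\<^sup>2) + (1 - \<alpha>) * (\<Sum>j\<in>?N i. y j)\<^sup>2)"
    unfolding sum_distrib_left using pointwise by (rule sum_mono)
  also have "\<dots> = \<alpha> * (D\<^sup>2 * ?Y) + (1 - \<alpha>) * (\<Sum>i\<in>V. (\<Sum>j\<in>?N i. y j)\<^sup>2)"
    by (simp add: sum.distrib sum_distrib_left)
  also have "\<dots> \<le> \<alpha> * (D\<^sup>2 * ?Y) + (1 - \<alpha>) * (\<Sum>j\<in>V. (y j)\<^sup>2 * S)"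
    using \<alpha> S
    by (intro add_left_mono mult_left_mono order_trans[OF sum_square_shadow_nbrs_le] sum_mono) auto
  also have "\<dots> = (\<alpha> * D\<^sup>2 + (1 - \<alpha>) * S) * ?Y"
    unfolding sum_distrib_right[symmetric] by (simp add: algebra_simps)
  finally show ?thesis using pos by simp
qed

end

section \<open>Combining the walk count with the spectral estimate\<close>

theorem theorem4p4:
  fixes V :: "'a set" and E :: "'a set set" and n k s t :: nat and \<alpha> :: real
  assumes "n \<ge> 3" and "k \<ge> 3" and "s \<ge> 2"
    and "1 \<le> t" and "real t \<le> 1 / 2 * (6 * real k ^ 2 - 15 * real k + 10) * (real s - 1) + 1"
    and "0 \<le> \<alpha>" and "\<alpha> < 1"
    and "uniform_hypergraph k V E" and "card V = n"
    and "linear_hypergraph E" and "connected_hypergraph V E"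
    and "\<not> contains_berge (book_verts s) (book_edges s) V E"
    and "\<not> contains_berge (K2_verts t) (K2_edges t) V E"
  shows "(alpha_spectral_radius \<alpha> k V E)\<^sup>2
    \<le> \<alpha> * ((real n - 1)\<^sup>2 / (real k - 1)\<^sup>2)
      + (1 - \<alpha>) * ((6 * real k ^ 2 - 15 * real k + 10) * (real s - 1) * (real n - 1)
          / (2 * (real k - 1)\<^sup>2))"
proof -
  interpret linear_uniform_hypergraph k V E
    using assms(8,10) by unfold_locales
  let ?N = "shadow_nbrs E"
  define T where "T = 1 / 2 * (6 * real k ^ 2 - 15 * real k + 10) * (real s - 1)"
  have deg: "card (?N v) \<le> n - 1" if "v \<in> V" for v
    using card_mono[OF _ shadow_nbrs_subset, of v] that finite_V assms(9) by simp
  have D: "real (card (?N v)) \<le> real n - 1" if "v \<in> V" for v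
    using deg[OF that] assms(1) by linarith
  have S: "(\<Sum>u\<in>?N v. real (card (?N u))) \<le> T * (real n - 1)" if v: "v \<in> V" for v
  proof -
    define d where "d = card (?N v)"
    have dn: "d \<le> n - 1" using deg[OF v] by (simp add: d_def)
    have "2 * (\<Sum>u\<in>?N v. card (?N u)) \<le> d * (2 * (k - 1) + 2 * ((s - 1) * (2 * k - 3))
        + 3 * (k - 2) * ((s - 1) * (2 * k - 3))) + 2 * ((t - 1) * (n - 1 - d))"
      using sum_card_shadow_nbrs_le[OF assms(12,13) v] assms(2,9) by (simp add: d_def)
    then have "real (2 * (\<Sum>u\<in>?N v. card (?N u))) \<le> real (d * (2 * (k - 1) + 2 * ((s - 1) * (2 * k - 3))
        + 3 * (k - 2) * ((s - 1) * (2 * k - 3))) + 2 * ((t - 1) * (n - 1 - d)))"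
      by (rule of_nat_mono)
    \<comment> \<open>Here \<open>2 * m + 3 * (k - 2) * m = (3 * k - 4) * m\<close> for
      \<open>m = (s - 1) * (2 * k - 3)\<close>; the bounds on \<open>k\<close>, \<open>s\<close>,
      \<open>t\<close> and \<open>d\<close> make all truncated subtractions exact.\<close>
    also have "\<dots> = d * (2 * (real k - 1) + (real s - 1) * (2 * real k - 3) * (3 * real k - 4))
        + 2 * ((real t - 1) * (real n - 1 - d))"
    proof -
      have "real (k - 1) = real k - 1" "real (k - 2) = real k - 2" "real (2 * k - 3) = 2 * real k - 3"
        "real (s - 1) = real s - 1" "real (t - 1) = real t - 1" "real (n - 1 - d) = real n - 1 - d"
        using assms(1-4) dn by linarith+
      then show ?thesis
        unfolding of_nat_add of_nat_mult by (simp add: algebra_simps)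
    qed
    also have "\<dots> \<le> d * (2 * T) + 2 * (T * (real n - 1 - d))"
    proof (intro add_mono mult_left_mono mult_right_mono)
      \<comment> \<open>As \<open>s - 1\<close> is at least 1, it can be factored out of the whole
        bracket; then \<open>(2 * k - 3) * (3 * k - 4) + 2 * (k - 1) = 6 * k^2 - 15 * k + 10\<close>
        is the source of the constant.\<close>
      have "1 * (2 * (real k - 1)) \<le> (real s - 1) * (2 * (real k - 1))"
        using assms(2,3) by (intro mult_right_mono) auto
      then show "2 * (real k - 1) + (real s - 1) * (2 * real k - 3) * (3 * real k - 4) \<le> 2 * T"
        unfolding T_def by (simp add: field_simps power2_eq_square)
      show "real t - 1 \<le> T" using assms(5) by (simp add: T_def)
      show "0 \<le> real n - 1 - d" using dn assms(1) by linarith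
    qed auto
    also have "\<dots> = 2 * (T * (real n - 1))" by (simp add: algebra_simps)
    finally show ?thesis by simp
  qed
  \<comment> \<open>A vertex yields an eigenvalue, so the supremum defining the spectral radius is
    attained by some \<open>\<mu>\<close>.\<close>
  have "V \<noteq> {}" using assms(1,9) by auto
  then obtain v where "v \<in> V" by blast
  then obtain \<mu> where eig: "tensor_eigenvalue k V (\<lambda>js. complex_of_real (alpha_tensor \<alpha> k E js)) \<mu>"
    and \<mu>: "cmod \<mu> = alpha_spectral_radius \<alpha> k V E"
    using tensor_spectral_radius_greatest(1)[OF finite_V alpha_tensor_eigenvalue_exists[OF assms(2,8)]]
    unfolding alpha_spectral_radius_def by blast
  have "((real k - 1) * cmod \<mu>)\<^sup>2 \<le> \<alpha> * (real n - 1)\<^sup>2 + (1 - \<alpha>) * (T * (real n - 1))"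
    using assms(2,6,7) by (intro eigenvalue_square_le[OF _ _ _ eig D S]) auto
  then have "(cmod \<mu>)\<^sup>2 \<le> (\<alpha> * (real n - 1)\<^sup>2 + (1 - \<alpha>) * (T * (real n - 1))) / (real k - 1)\<^sup>2"
    using assms(2) by (simp add: power_mult_distrib pos_le_divide_eq mult.commute)
  also have "\<dots> = \<alpha> * ((real n - 1)\<^sup>2 / (real k - 1)\<^sup>2)
      + (1 - \<alpha>) * ((6 * real k ^ 2 - 15 * real k + 10) * (real s - 1) * (real n - 1)
          / (2 * (real k - 1)\<^sup>2))"
  proof -
    have "(\<alpha> * a + (1 - \<alpha>) * (1 / 2 * p * q * r)) / c = \<alpha> * (a / c) + (1 - \<alpha>) * (p * q * r / (2 * c))"
      for a p q r c :: real
      by (simp add: add_divide_distrib)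
    then show ?thesis unfolding T_def .
  qed
  finally show ?thesis unfolding \<mu> .
qed

end
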